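(* Let $M$ be an odd-dimensional smooth manifold with an almost paracontact structure $(\varphi,\xi,\eta)$, and let $\Phi=\begin{pmatrix}\varphi & 0\\ 0 & -\varphi^*\end{pmatrix}$ be the endomorphism of $TM\oplus T^*M$ of the induced generalized almost paracontact structure. Let $B$ be a closed $2$-form on $M$ and let $\Phi_B:=e^B\Phi e^{-B}$, where $e^{B}=\begin{pmatrix}I & 0\\ B & I\end{pmatrix}$. If $B(\varphi^2X,Y)=B(\varphi X,\varphi Y)$ for all $X,Y\in\Gamma(TM)$, then $(\Phi_B,\xi,\eta)$ is a generalized almost paracontact structure on $M$.
   Context: An almost paracontact structure $(\varphi,\xi,\eta)$ on an odd-dimensional manifold $M$ consists of a $(1,1)$-tensor field $\varphi$, a vector field $\xi$ and a $1$-form $\eta$ such that $\varphi^2=I-\eta\otimes\xi$ (i.e. $\varphi^2X=X-\eta(X)\xi$) and $\eta(\xi)=1$. The paper takes these conditions to include $\varphi\xi=0$ and $\eta\circ\varphi=0$. Sections of $TM\oplus T^*M$ are written $X+\alpha$ with $X$ a vector field and $\alpha$ a $1$-form; block matrices act as on columns $(X,\alpha)^T$. For an endomorphism $A$ of $TM$, its dual $A^*$ is $(A^*\alpha)(X)=\alpha(AX)$. A $2$-form $B$ is viewed as the map $B:\Gamma(TM)\to\Gamma(T^*M)$, $B(X)(Y)=B(X,Y)$. The neutral metric on $TM\oplus T^*M$ is $g_0(X+\alpha,Y+\gamma)=\frac12(\alpha(Y)+\gamma(X))$. A triple $(\Psi,\xi,\eta)$, with $\Psi$ an endomorphism of $TM\oplus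 T^*M$, $\xi$ a vector field and $\eta$ a $1$-form on $M$, is a generalized almost paracontact structure if: (1) $g_0(\Psi(X+\alpha),Y+\gamma)=-g_0(X+\alpha,\Psi(Y+\gamma))$ for all $X+\alpha,Y+\gamma\in\Gamma(TM\oplus T^*M)$; (2) $\Psi^2=\begin{pmatrix}I-\eta\otimes\xi & 0\\ 0 & (I-\eta\otimes\xi)^*\end{pmatrix}$; (3) $\Psi\begin{pmatrix}\eta\otimes\xi & 0\\ 0 & (\eta\otimes\xi)^*\end{pmatrix}=0$; (4) $\|\xi+\eta\|_{g_0}=1$, i.e. $g_0(\xi+\eta,\xi+\eta)=1$. Here $(\eta\otimes\xi)X=\eta(X)\xi$. *)

theory Defs
  imports "HOL-Analysis.Analysis" "HOL-Library.Function_Algebras"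
begin

section \<open>Smooth manifolds\<close>

text \<open>\<open>C_k_on k S f\<close>: \<open>f\<close> is \<open>k\<close> times continuously differentiable on the (open) set \<open>S\<close>.\<close>

fun C_k_on :: "nat \<Rightarrow> 'a::euclidean_space set \<Rightarrow> ('a \<Rightarrow> 'b::real_normed_vector) \<Rightarrow> bool" where
  "C_k_on 0 S f \<longleftrightarrow> continuous_on S f"
| "C_k_on (Suc k) S f \<longleftrightarrow>
     (\<forall>x\<in>S. f differentiable (at x)) \<and> (\<forall>v. C_k_on k S (\<lambda>x. frechet_derivative f (at x) v))"

definition smooth_on :: "'a::euclidean_space set \<Rightarrow> ('a \<Rightarrow> 'b::real_normed_vector) \<Rightarrow> bool" where
  "smooth_on S f \<longleftrightarrow> (\<forall>k. C_k_on k S f)"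

type_synonym ('m, 'e) atlas = "('m set \<times> ('m \<Rightarrow> 'e)) set"

text \<open>The points of the manifold are the elements of a Hausdorff, second countable type \<open>'m\<close>; its
  dimension is the dimension of the model space \<open>'e\<close>. A chart is a pair of its domain and its
  coordinate map (whose values off the domain are irrelevant). The atlas need not be maximal.\<close>

definition smooth_manifold ::
  "('m::{t2_space,second_countable_topology}, 'e::euclidean_space) atlas \<Rightarrow> bool" where
  "smooth_manifold M \<longleftrightarrow>
     (\<Union>(U, x)\<in>M. U) = UNIV \<and>
     (\<forall>(U, x)\<in>M. open U \<and> open (x ` U) \<and> homeomorphism U (x ` U) x (inv_into U x)) \<and>
     (\<forall>(U, x)\<in>M. \<forall>(V, y)\<in>M. smooth_on (x ` (U \<inter> V)) (y \<circ> inv_into U x))"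

definition smooth_functions ::
  "('m::{t2_space,second_countable_topology}, 'e::euclidean_space) atlas \<Rightarrow> ('m \<Rightarrow> real) set" where
  "smooth_functions M = {f. \<forall>(U, x)\<in>M. smooth_on (x ` U) (f \<circ> inv_into U x)}"


section \<open>Vector fields and forms\<close>

text \<open>Sums, differences, products and constants of functions are the pointwise ones of
  \<^theory>\<open>HOL-Library.Function_Algebras\<close>. Tangent vectors at \<open>p\<close> are the derivations at \<open>p\<close> of
  the algebra of smooth functions. Derivations and 1-forms are extended by zero outside their
  domains, so that equality of the total functions is equality of the tensor fields.\<close>

definition tangent_space ::
  "('m::{t2_space,second_countable_topology}, 'e::euclidean_space) atlas \<Rightarrow> 'm
    \<Rightarrow> (('m \<Rightarrow> real) \<Rightarrow> real) set" where
  "tangent_space M p = {v.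
     (\<forall>f\<in>smooth_functions M. \<forall>g\<in>smooth_functions M.
        v (f + g) = v f + v g \<and> v (f * g) = f p * v g + g p * v f) \<and>
     (\<forall>c. \<forall>f\<in>smooth_functions M. v (\<lambda>q. c * f q) = c * v f) \<and>
     (\<forall>f. f \<notin> smooth_functions M \<longrightarrow> v f = 0)}"

type_synonym 'm vfield = "('m \<Rightarrow> real) \<Rightarrow> 'm \<Rightarrow> real"
type_synonym 'm form = "'m vfield \<Rightarrow> 'm \<Rightarrow> real"

text \<open>A vector field takes the function first: the tangent vector at \<open>p\<close> is \<open>\<lambda>f. X f p\<close>, and
  \<open>X f\<close> is the derivative of \<open>f\<close> along \<open>X\<close>.\<close>

definition vector_fields ::
  "('m::{t2_space,second_countable_topology}, 'e::euclidean_space) atlas \<Rightarrow> 'm vfield set" where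
  "vector_fields M = {X. (\<forall>p. (\<lambda>f. X f p) \<in> tangent_space M p) \<and>
     (\<forall>f\<in>smooth_functions M. X f \<in> smooth_functions M)}"

text \<open>Multiplication of a vector field or 1-form by a function.\<close>

definition fsmult :: "('m \<Rightarrow> real) \<Rightarrow> ('x \<Rightarrow> 'm \<Rightarrow> real) \<Rightarrow> 'x \<Rightarrow> 'm \<Rightarrow> real" where
  "fsmult f T = (\<lambda>x. f * T x)"

text \<open>Linearity over the ring \<open>R\<close> of smooth functions of a map from \<open>S\<close> to \<open>T\<close>, where \<open>s\<close> and \<open>t\<close>
  are the scalar multiplications. Tensor fields are treated as maps of this kind between spaces of
  sections (the tensor characterization lemma).\<close>

definition linear_over ::
  "'r set \<Rightarrow> ('r \<Rightarrow> 'a::plus \<Rightarrow> 'a) \<Rightarrow> 'a set \<Rightarrow> ('r \<Rightarrow> 'b::plus \<Rightarrow> 'b) \<Rightarrow> 'b set \<Rightarrow> ('a \<Rightarrow> 'b) \<Rightarrow> bool" where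
  "linear_over R s S t T F \<longleftrightarrow> F ` S \<subseteq> T \<and>
     (\<forall>x\<in>S. \<forall>y\<in>S. F (x + y) = F x + F y) \<and> (\<forall>r\<in>R. \<forall>x\<in>S. F (s r x) = t r (F x))"

definition one_forms ::
  "('m::{t2_space,second_countable_topology}, 'e::euclidean_space) atlas \<Rightarrow> 'm form set" where
  "one_forms M = {\<alpha>.
     linear_over (smooth_functions M) fsmult (vector_fields M) (*) (smooth_functions M) \<alpha> \<and>
     (\<forall>X. X \<notin> vector_fields M \<longrightarrow> \<alpha> X = 0)}"

text \<open>A 2-form is curried, i.e. it is the map from vector fields to 1-forms that sends \<open>X\<close> to
  \<open>B(X, -)\<close>.\<close>

definition two_forms ::
  "('m::{t2_space,second_countable_topology}, 'e::euclidean_space) atlas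
    \<Rightarrow> ('m vfield \<Rightarrow> 'm form) set" where
  "two_forms M = {B.
     linear_over (smooth_functions M) fsmult (vector_fields M) fsmult (one_forms M) B \<and>
     (\<forall>X\<in>vector_fields M. B X X = 0)}"

definition lie_bracket ::
  "('m::{t2_space,second_countable_topology}, 'e::euclidean_space) atlas
    \<Rightarrow> 'm vfield \<Rightarrow> 'm vfield \<Rightarrow> 'm vfield" where
  "lie_bracket M X Y f = (if f \<in> smooth_functions M then X (Y f) - Y (X f) else 0)"

text \<open>The exterior derivative of a 2-form, by the invariant formula (without a factor \<open>1/3\<close>).\<close>

definition ext_deriv ::
  "('m::{t2_space,second_countable_topology}, 'e::euclidean_space) atlas
    \<Rightarrow> ('m vfield \<Rightarrow> 'm form) \<Rightarrow> 'm vfield \<Rightarrow> 'm vfield \<Rightarrow> 'm vfield \<Rightarrow> 'm \<Rightarrow> real" where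
  "ext_deriv M B X Y Z =
     X (B Y Z) - Y (B X Z) + Z (B X Y)
     - B (lie_bracket M X Y) Z + B (lie_bracket M X Z) Y - B (lie_bracket M Y Z) X"

definition closed_two_form ::
  "('m::{t2_space,second_countable_topology}, 'e::euclidean_space) atlas
    \<Rightarrow> ('m vfield \<Rightarrow> 'm form) \<Rightarrow> bool" where
  "closed_two_form M B \<longleftrightarrow> B \<in> two_forms M \<and>
     (\<forall>X\<in>vector_fields M. \<forall>Y\<in>vector_fields M. \<forall>Z\<in>vector_fields M. ext_deriv M B X Y Z = 0)"


section \<open>Endomorphisms of \<open>TM\<close> and \<open>TM \<oplus> T*M\<close>\<close>

definition tangent_endomorphism ::
  "('m::{t2_space,second_countable_topology}, 'e::euclidean_space) atlas
    \<Rightarrow> ('m vfield \<Rightarrow> 'm vfield) \<Rightarrow> bool" where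
  "tangent_endomorphism M A \<longleftrightarrow>
     linear_over (smooth_functions M) fsmult (vector_fields M) fsmult (vector_fields M) A"

text \<open>The section \<open>X + \<alpha>\<close> is the pair \<open>(X, \<alpha>)\<close>.\<close>

type_synonym 'm gsection = "'m vfield \<times> 'm form"

definition gen_sections ::
  "('m::{t2_space,second_countable_topology}, 'e::euclidean_space) atlas \<Rightarrow> 'm gsection set" where
  "gen_sections M = vector_fields M \<times> one_forms M"

definition gen_fsmult :: "('m \<Rightarrow> real) \<Rightarrow> 'm gsection \<Rightarrow> 'm gsection" where
  "gen_fsmult f = map_prod (fsmult f) (fsmult f)"

definition gen_endomorphism ::
  "('m::{t2_space,second_countable_topology}, 'e::euclidean_space) atlas
    \<Rightarrow> ('m gsection \<Rightarrow> 'm gsection) \<Rightarrow> bool" where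
  "gen_endomorphism M \<Psi> \<longleftrightarrow>
     linear_over (smooth_functions M) gen_fsmult (gen_sections M) gen_fsmult (gen_sections M) \<Psi>"

definition dual_map ::
  "('m::{t2_space,second_countable_topology}, 'e::euclidean_space) atlas
    \<Rightarrow> ('m vfield \<Rightarrow> 'm vfield) \<Rightarrow> 'm form \<Rightarrow> 'm form" where
  "dual_map M A \<alpha> X = (if X \<in> vector_fields M then \<alpha> (A X) else 0)"

definition tensor :: "'m form \<Rightarrow> 'm vfield \<Rightarrow> 'm vfield \<Rightarrow> 'm vfield" (infixl "\<otimes>\<^sub>T" 70) where
  "(\<eta> \<otimes>\<^sub>T \<xi>) X = fsmult (\<eta> X) \<xi>"

text \<open>\<open>block P Q R S\<close> is the block matrix with first row \<open>P, Q\<close> and second row \<open>R, S\<close>.\<close>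

definition block ::
  "('m vfield \<Rightarrow> 'm vfield) \<Rightarrow> ('m form \<Rightarrow> 'm vfield) \<Rightarrow>
   ('m vfield \<Rightarrow> 'm form) \<Rightarrow> ('m form \<Rightarrow> 'm form) \<Rightarrow> 'm gsection \<Rightarrow> 'm gsection" where
  "block P Q R S = (\<lambda>(X, \<alpha>). (P X + Q \<alpha>, R X + S \<alpha>))"

definition g0 :: "'m gsection \<Rightarrow> 'm gsection \<Rightarrow> 'm \<Rightarrow> real" where
  "g0 = (\<lambda>(X, \<alpha>) (Y, \<gamma>) p. (\<alpha> Y p + \<gamma> X p) / 2)"


section \<open>(Generalized) almost paracontact structures\<close>

definition almost_paracontact ::
  "('m::{t2_space,second_countable_topology}, 'e::euclidean_space) atlas
    \<Rightarrow> ('m vfield \<Rightarrow> 'm vfield) \<Rightarrow> 'm vfield \<Rightarrow> 'm form \<Rightarrow> bool" where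
  "almost_paracontact M \<phi> \<xi> \<eta> \<longleftrightarrow>
     tangent_endomorphism M \<phi> \<and> \<xi> \<in> vector_fields M \<and> \<eta> \<in> one_forms M \<and>
     (\<forall>X\<in>vector_fields M. \<phi> (\<phi> X) = X - fsmult (\<eta> X) \<xi>) \<and>
     \<eta> \<xi> = 1 \<and> \<phi> \<xi> = 0 \<and> (\<forall>X\<in>vector_fields M. \<eta> (\<phi> X) = 0)"

definition gen_almost_paracontact ::
  "('m::{t2_space,second_countable_topology}, 'e::euclidean_space) atlas
    \<Rightarrow> ('m gsection \<Rightarrow> 'm gsection) \<Rightarrow> 'm vfield \<Rightarrow> 'm form \<Rightarrow> bool" where
  "gen_almost_paracontact M \<Psi> \<xi> \<eta> \<longleftrightarrow>
     gen_endomorphism M \<Psi> \<and> \<xi> \<in> vector_fields M \<and> \<eta> \<in> one_forms M \<and>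
     (\<forall>s\<in>gen_sections M. \<forall>t\<in>gen_sections M. g0 (\<Psi> s) t = - g0 s (\<Psi> t)) \<and>
     (\<forall>s\<in>gen_sections M.
        \<Psi> (\<Psi> s) = block (id - \<eta> \<otimes>\<^sub>T \<xi>) 0 0 (dual_map M (id - \<eta> \<otimes>\<^sub>T \<xi>)) s) \<and>
     (\<forall>s\<in>gen_sections M. \<Psi> (block (\<eta> \<otimes>\<^sub>T \<xi>) 0 0 (dual_map M (\<eta> \<otimes>\<^sub>T \<xi>)) s) = 0) \<and>
     g0 (\<xi>, \<eta>) (\<xi>, \<eta>) = 1"

definition induced_endomorphism ::
  "('m::{t2_space,second_countable_topology}, 'e::euclidean_space) atlas
    \<Rightarrow> ('m vfield \<Rightarrow> 'm vfield) \<Rightarrow> 'm gsection \<Rightarrow> 'm gsection" where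
  "induced_endomorphism M \<phi> = block \<phi> 0 0 (- dual_map M \<phi>)"

definition exp_B :: "('m vfield \<Rightarrow> 'm form) \<Rightarrow> 'm gsection \<Rightarrow> 'm gsection" where
  "exp_B B = block id 0 B id"

end

theory Submission
  imports Defs
begin

text \<open>
  Multiplying out the conjugation gives
  \<open>\<Phi>\<^sub>B (X + \<alpha>) = \<phi> X + (C X - \<phi>\<^sup>* \<alpha>)\<close> with \<open>C = B \<circ> \<phi> + \<phi>\<^sup>* \<circ> B\<close>, that is
  \<open>C(X, Y) = B(\<phi> X, Y) + B(X, \<phi> Y)\<close>. Each axiom thereby becomes a statement about the bilinear
  form \<open>B\<close> and the endomorphism \<open>\<phi>\<close>:

  \<^item> \<open>\<Phi>\<^sub>B\<close> is skew for \<open>g0\<close> because \<open>C\<close> is again skew-symmetric.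
  \<^item> The square of \<open>\<Phi>\<^sub>B\<close> is \<open>e\<^sup>B \<Phi>\<^sup>2 e\<^sup>-\<^sup>B\<close>. It agrees with \<open>\<Phi>\<^sup>2\<close> exactly if
    \<open>B(\<phi>\<^sup>2 X, Y) = B(X, \<phi>\<^sup>2 Y)\<close>. This follows from the compatibility condition on \<open>B\<close> and \<open>\<phi>\<close>:
    its right-hand side \<open>B(\<phi> X, \<phi> Y)\<close> is skew in \<open>X\<close> and \<open>Y\<close>, so its left-hand side is too
    (\<open>two_form_phi_square_symmetric\<close>).
  \<^item> \<open>\<Phi>\<^sub>B\<close> annihilates the part along \<open>\<xi>\<close> and \<open>\<eta>\<close> provided that \<open>B(\<xi>, \<phi> Y) = 0\<close>. Since
    \<open>\<phi>\<^sup>3 = \<phi>\<close>, the symmetry just mentioned gives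
    \<open>B(\<xi>, \<phi> Y) = B(\<xi>, \<phi>\<^sup>2 (\<phi> Y)) = B(\<phi>\<^sup>2 \<xi>, \<phi> Y) = 0\<close> (\<open>two_form_xi_phi_zero\<close>).
  \<^item> The norm of \<open>\<xi> + \<eta>\<close> is \<open>\<eta>(\<xi>) = 1\<close>.

  The remaining work is to see that \<open>\<Phi>\<^sub>B\<close> sends sections to sections. Here forms and fields are
  maps on global smooth functions, so this rests on the smooth functions being a ring, which in
  turn is the product rule applied to all orders of differentiability.
\<close>


section \<open>The ring of smooth functions\<close>

text \<open>Openness matters because the Frechet derivatives at a point depend on a neighbourhood.\<close>

lemma C_k_on_cong:
  assumes "open S" "\<And>x. x \<in> S \<Longrightarrow> f x = g x" "C_k_on k S f"
  shows "C_k_on k S g"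
  using assms(2,3)
proof (induction k arbitrary: f g)
  case 0
  then show ?case by (auto cong: continuous_on_cong)
next
  case (Suc k)
  have deriv: "(g has_derivative D) (at x)" if "x \<in> S" "(f has_derivative D) (at x)" for x D
    using has_derivative_transform_within_open[OF that(2) assms(1) that(1)] Suc.prems(1) by blast
  have diff: "f differentiable at x" if "x \<in> S" for x
    using Suc.prems(2) that by simp
  have gdiff: "g differentiable at x" if "x \<in> S" for x
    using deriv diff that unfolding differentiable_def by blast
  have eq: "frechet_derivative f (at x) = frechet_derivative g (at x)" if "x \<in> S" for x
    using deriv[OF that] diff[OF that] frechet_derivative_works frechet_derivative_at by blast
  have "C_k_on k S (\<lambda>x. frechet_derivative g (at x) v)" for v
    using Suc.IH[of "\<lambda>x. frechet_derivative f (at x) v"] Suc.prems(2) eq by simp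
  with gdiff show ?case by simp
qed

lemma C_k_on_Suc_imp: "C_k_on (Suc k) S f \<Longrightarrow> C_k_on k S f"
proof (induction k arbitrary: f)
  case 0
  then show ?case
    by (auto intro!: continuous_at_imp_continuous_on differentiable_imp_continuous_within)
next
  case (Suc k)
  then show ?case by (metis C_k_on.simps(2))
qed

lemma C_k_on_const: "C_k_on k S (\<lambda>x. c)"
  by (induction k arbitrary: c) simp_all

lemma C_k_on_add:
  assumes "open S" "C_k_on k S f" "C_k_on k S g"
  shows "C_k_on k S (\<lambda>x. f x + g x)"
  using assms(2,3)
proof (induction k arbitrary: f g)
  case 0
  then show ?case by (simp add: continuous_on_add)
next
  case (Suc k)
  have eq: "frechet_derivative (\<lambda>x. f x + g x) (at x) =
      (\<lambda>v. frechet_derivative f (at x) v + frechet_derivative g (at x) v)" if "x \<in> S" for x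
    using Suc.prems that by (intro frechet_derivative_at[symmetric] has_derivative_add)
      (simp_all flip: frechet_derivative_works)
  have "C_k_on k S (\<lambda>x. frechet_derivative (\<lambda>x. f x + g x) (at x) v)" for v
    by (rule C_k_on_cong[OF assms(1) _ Suc.IH]) (use Suc.prems eq in auto)
  with Suc.prems show ?case by simp
qed

lemma C_k_on_mult:
  fixes f g :: "'a::euclidean_space \<Rightarrow> real"
  assumes "open S" "C_k_on k S f" "C_k_on k S g"
  shows "C_k_on k S (\<lambda>x. f x * g x)"
  using assms(2,3)
proof (induction k arbitrary: f g)
  case 0
  then show ?case by (simp add: continuous_on_mult)
next
  case (Suc k)
  have eq: "frechet_derivative (\<lambda>x. f x * g x) (at x) =
      (\<lambda>v. f x * frechet_derivative g (at x) v + frechet_derivative f (at x) v * g x)"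
    if "x \<in> S" for x
    using Suc.prems that by (intro frechet_derivative_at[symmetric] has_derivative_mult)
      (simp_all flip: frechet_derivative_works)
  have "C_k_on k S (\<lambda>x. frechet_derivative (\<lambda>x. f x * g x) (at x) v)" for v
  proof (rule C_k_on_cong[OF assms(1)])
    show "C_k_on k S (\<lambda>x. f x * frechet_derivative g (at x) v + frechet_derivative f (at x) v * g x)"
      using Suc.prems C_k_on_Suc_imp by (intro C_k_on_add[OF assms(1)] Suc.IH) auto
  qed (simp add: eq)
  with Suc.prems show ?case by simp
qed

lemma smooth_functions_const: "(\<lambda>p. c) \<in> smooth_functions M"
  by (auto simp: smooth_functions_def smooth_on_def o_def C_k_on_const)

lemma smooth_functions_add:
  assumes "smooth_manifold M" "f \<in> smooth_functions M" "g \<in> smooth_functions M"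
  shows "f + g \<in> smooth_functions M"
  using assms C_k_on_add
  by (fastforce simp: smooth_manifold_def smooth_functions_def smooth_on_def o_def)

lemma smooth_functions_mult:
  assumes "smooth_manifold M" "f \<in> smooth_functions M" "g \<in> smooth_functions M"
  shows "f * g \<in> smooth_functions M"
  using assms C_k_on_mult
  by (fastforce simp: smooth_manifold_def smooth_functions_def smooth_on_def o_def)

lemma smooth_functions_diff:
  assumes "smooth_manifold M" "f \<in> smooth_functions M" "g \<in> smooth_functions M"
  shows "f - g \<in> smooth_functions M"
proof -
  have "f - g = f + (\<lambda>p. - 1) * g" by (simp add: fun_eq_iff)
  then show ?thesis
    using assms smooth_functions_add smooth_functions_mult smooth_functions_const by metis
qed


section \<open>Modules of fields and forms\<close>

lemma linear_over_image: "linear_over R s S t T F \<Longrightarrow> x \<in> S \<Longrightarrow> F x \<in> T"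
  and linear_over_add: "linear_over R s S t T F \<Longrightarrow> x \<in> S \<Longrightarrow> y \<in> S \<Longrightarrow> F (x + y) = F x + F y"
  and linear_over_scale: "linear_over R s S t T F \<Longrightarrow> r \<in> R \<Longrightarrow> x \<in> S \<Longrightarrow> F (s r x) = t r (F x)"
  by (auto simp: linear_over_def)

lemma linear_over_zero:
  fixes F :: "'a::monoid_add \<Rightarrow> 'b::group_add"
  assumes "linear_over R s S t T F" "0 \<in> S"
  shows "F 0 = 0"
proof -
  have "F 0 + F 0 = F 0 + 0" using linear_over_add[OF assms(1) assms(2) assms(2)] by simp
  then show ?thesis by (rule add_left_imp_eq)
qed

lemma vector_fields_add:
  assumes "smooth_manifold M" "X \<in> vector_fields M" "Y \<in> vector_fields M"
  shows "X + Y \<in> vector_fields M"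
  using assms(2,3) smooth_functions_add[OF assms(1)]
  by (auto simp: vector_fields_def tangent_space_def algebra_simps)

lemma vector_fields_fsmult:
  assumes "smooth_manifold M" "f \<in> smooth_functions M" "X \<in> vector_fields M"
  shows "fsmult f X \<in> vector_fields M"
  using assms(2,3) smooth_functions_mult[OF assms(1)]
  by (auto simp: vector_fields_def tangent_space_def fsmult_def algebra_simps)

lemma one_forms_linear:
  "\<alpha> \<in> one_forms M \<Longrightarrow>
    linear_over (smooth_functions M) fsmult (vector_fields M) (*) (smooth_functions M) \<alpha>"
  by (simp add: one_forms_def)

lemma one_forms_outside: "\<alpha> \<in> one_forms M \<Longrightarrow> X \<notin> vector_fields M \<Longrightarrow> \<alpha> X = 0"
  by (simp add: one_forms_def)

lemma one_forms_add:
  assumes "smooth_manifold M" "\<alpha> \<in> one_forms M" "\<beta> \<in> one_forms M"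
  shows "\<alpha> + \<beta> \<in> one_forms M"
  using assms(2,3) smooth_functions_add[OF assms(1)]
  by (auto simp: one_forms_def linear_over_def image_subset_iff algebra_simps)

lemma one_forms_diff:
  assumes "smooth_manifold M" "\<alpha> \<in> one_forms M" "\<beta> \<in> one_forms M"
  shows "\<alpha> - \<beta> \<in> one_forms M"
  using assms(2,3) smooth_functions_diff[OF assms(1)]
  by (auto simp: one_forms_def linear_over_def image_subset_iff algebra_simps)

lemma one_forms_dual_map:
  assumes "smooth_manifold M" "tangent_endomorphism M A" "\<alpha> \<in> one_forms M"
  shows "dual_map M A \<alpha> \<in> one_forms M"
  using assms(2,3) vector_fields_add[OF assms(1)] vector_fields_fsmult[OF assms(1)]
  by (auto simp: one_forms_def linear_over_def image_subset_iff dual_map_def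
      tangent_endomorphism_def)

lemma dual_map_add: "dual_map M A (\<alpha> + \<beta>) = dual_map M A \<alpha> + dual_map M A \<beta>"
  and dual_map_fsmult: "dual_map M A (fsmult f \<alpha>) = fsmult f (dual_map M A \<alpha>)"
  by (auto simp: fun_eq_iff dual_map_def fsmult_def)

lemma two_forms_linear:
  "B \<in> two_forms M \<Longrightarrow>
    linear_over (smooth_functions M) fsmult (vector_fields M) fsmult (one_forms M) B"
  by (simp add: two_forms_def)

lemma two_forms_skew:
  assumes "smooth_manifold M" "B \<in> two_forms M" "X \<in> vector_fields M" "Y \<in> vector_fields M"
  shows "B X Y = - B Y X"
proof -
  note B_lin = two_forms_linear[OF assms(2)]
  have XY: "X + Y \<in> vector_fields M" using assms vector_fields_add by blast
  have "0 = B (X + Y) (X + Y)" using XY assms(2) by (simp add: two_forms_def)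
  also have "\<dots> = B X (X + Y) + B Y (X + Y)"
    by (simp only: linear_over_add[OF B_lin assms(3,4)] plus_fun_apply)
  also have "\<dots> = (B X X + B X Y) + (B Y X + B Y Y)"
    using linear_over_add[OF one_forms_linear[OF linear_over_image[OF B_lin assms(3)]] assms(3,4)]
      linear_over_add[OF one_forms_linear[OF linear_over_image[OF B_lin assms(4)]] assms(3,4)]
    by (simp only:)
  also have "\<dots> = B X Y + B Y X" using assms by (simp add: two_forms_def)
  finally show ?thesis by (simp add: eq_neg_iff_add_eq_0)
qed


section \<open>A 2-form compatible with an almost paracontact structure\<close>

text \<open>The compatibility condition identifies \<open>B(\<phi>\<^sup>2 X, Y)\<close> with the form \<open>B(\<phi> X, \<phi> Y)\<close>, which is
  skew in \<open>X\<close> and \<open>Y\<close>; moving \<open>\<phi>\<^sup>2\<close> to the other side costs two signs.\<close>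

lemma two_form_phi_square_symmetric:
  assumes "smooth_manifold M" "tangent_endomorphism M \<phi>" "B \<in> two_forms M"
    and compat: "\<forall>X\<in>vector_fields M. \<forall>Y\<in>vector_fields M. B (\<phi> (\<phi> X)) Y = B (\<phi> X) (\<phi> Y)"
    and X: "X \<in> vector_fields M" and Y: "Y \<in> vector_fields M"
  shows "B (\<phi> (\<phi> X)) Y = B X (\<phi> (\<phi> Y))"
proof -
  have \<phi>: "\<phi> Z \<in> vector_fields M" if "Z \<in> vector_fields M" for Z
    using assms(2) that linear_over_image unfolding tangent_endomorphism_def by metis
  note skew = two_forms_skew[OF assms(1,3)]
  have "B (\<phi> (\<phi> X)) Y = B (\<phi> X) (\<phi> Y)" using compat X Y by blast
  also have "\<dots> = - B (\<phi> Y) (\<phi> X)" by (intro skew \<phi> X Y)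
  also have "\<dots> = - B (\<phi> (\<phi> Y)) X" using compat X Y by simp
  also have "\<dots> = B X (\<phi> (\<phi> Y))" using skew[OF X \<phi>[OF \<phi>[OF Y]]] by simp
  finally show ?thesis .
qed

text \<open>The image of \<open>\<phi>\<close> is the image of \<open>\<phi>\<^sup>2\<close>, and \<open>\<phi>\<^sup>2\<close> can be moved onto \<open>\<xi>\<close>, which it kills.\<close>

lemma two_form_xi_phi_zero:
  assumes "smooth_manifold M" and "almost_paracontact M \<phi> \<xi> \<eta>" and B: "B \<in> two_forms M"
    and compat: "\<forall>X\<in>vector_fields M. \<forall>Y\<in>vector_fields M. B (\<phi> (\<phi> X)) Y = B (\<phi> X) (\<phi> Y)"
    and Y: "Y \<in> vector_fields M"
  shows "B \<xi> (\<phi> Y) = 0"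
proof -
  note ap = assms(2)[unfolded almost_paracontact_def]
  have \<phi>: "tangent_endomorphism M \<phi>"
    and \<xi>: "\<xi> \<in> vector_fields M" "\<phi> \<xi> = 0"
    using ap by blast+
  have \<phi>2: "\<phi> (\<phi> X) = X - fsmult (\<eta> X) \<xi>" "\<eta> (\<phi> X) = 0" if "X \<in> vector_fields M" for X
    using ap that by blast+
  note \<phi>_lin = \<phi>[unfolded tangent_endomorphism_def]
  have \<phi>Y: "\<phi> Y \<in> vector_fields M"
    by (rule linear_over_image[OF \<phi>_lin Y])
  have zero: "0 \<in> vector_fields M"
    using linear_over_image[OF \<phi>_lin \<xi>(1)] \<xi>(2) by simp
  have "fsmult 0 \<xi> = 0" by (simp add: fsmult_def fun_eq_iff)
  then have cube: "\<phi> (\<phi> (\<phi> Y)) = \<phi> Y"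
    using \<phi>2(1)[OF \<phi>Y] \<phi>2(2)[OF Y] by simp
  have "B \<xi> (\<phi> Y) = B (\<phi> (\<phi> \<xi>)) (\<phi> Y)"
    using two_form_phi_square_symmetric[where \<phi> = \<phi> and B = B, OF assms(1) \<phi> B compat \<xi>(1) \<phi>Y] unfolding cube
    by (rule sym)
  also have "\<dots> = 0"
    unfolding \<xi>(2) linear_over_zero[OF \<phi>_lin zero] linear_over_zero[OF two_forms_linear[OF B] zero]
    by simp
  finally show ?thesis .
qed


section \<open>The B-field transform\<close>

lemma B_transform_apply:
  "(exp_B B \<circ> induced_endomorphism M \<phi> \<circ> exp_B (- B)) (X, \<alpha>) =
    (\<phi> X, B (\<phi> X) + dual_map M \<phi> (B X) - dual_map M \<phi> \<alpha>)"
  by (simp add: exp_B_def induced_endomorphism_def block_def fun_eq_iff dual_map_def)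

lemma B_transform_gen_endomorphism:
  assumes M: "smooth_manifold M" and \<phi>: "tangent_endomorphism M \<phi>" and B: "B \<in> two_forms M"
  shows "gen_endomorphism M (exp_B B \<circ> induced_endomorphism M \<phi> \<circ> exp_B (- B))"
proof -
  note \<phi>_lin = \<phi>[unfolded tangent_endomorphism_def]
  note B_lin = two_forms_linear[OF B]
  \<comment> \<open>The lower left block: linearity of the transform reduces to that of this map.\<close>
  let ?C = "\<lambda>X. B (\<phi> X) + dual_map M \<phi> (B X)"
  have C_form: "?C X \<in> one_forms M" if "X \<in> vector_fields M" for X
    using that linear_over_image[OF \<phi>_lin] linear_over_image[OF B_lin]
    by (blast intro: one_forms_add[OF M] one_forms_dual_map[OF M \<phi>])
  have C_add: "?C (X + Y) = ?C X + ?C Y" if "X \<in> vector_fields M" "Y \<in> vector_fields M" for X Y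
    unfolding linear_over_add[OF \<phi>_lin that] linear_over_add[OF B_lin that] dual_map_add
      linear_over_add[OF B_lin linear_over_image[OF \<phi>_lin that(1)] linear_over_image[OF \<phi>_lin that(2)]]
    by (simp only: add_ac)
  have C_scale: "?C (fsmult r X) = fsmult r (?C X)"
    if "r \<in> smooth_functions M" "X \<in> vector_fields M" for r X
    using that by (simp add: linear_over_scale[OF \<phi>_lin] linear_over_scale[OF B_lin]
        linear_over_image[OF \<phi>_lin] dual_map_fsmult) (simp add: fsmult_def fun_eq_iff distrib_left)
  show ?thesis
    unfolding gen_endomorphism_def linear_over_def gen_sections_def image_subset_iff
  proof (intro conjI ballI)
    fix s assume "s \<in> vector_fields M \<times> one_forms M"
    then obtain X \<alpha> where s: "s = (X, \<alpha>)" "X \<in> vector_fields M" "\<alpha> \<in> one_forms M" by blast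
    show "(exp_B B \<circ> induced_endomorphism M \<phi> \<circ> exp_B (- B)) s \<in> vector_fields M \<times> one_forms M"
      unfolding s(1) B_transform_apply
      using linear_over_image[OF \<phi>_lin s(2)] one_forms_diff[OF M C_form[OF s(2)]
          one_forms_dual_map[OF M \<phi> s(3)]] by blast
  next
    fix s t assume "s \<in> vector_fields M \<times> one_forms M" "t \<in> vector_fields M \<times> one_forms M"
    then obtain X \<alpha> Y \<gamma> where st: "s = (X, \<alpha>)" "t = (Y, \<gamma>)"
        "X \<in> vector_fields M" "Y \<in> vector_fields M" by blast
    show "(exp_B B \<circ> induced_endomorphism M \<phi> \<circ> exp_B (- B)) (s + t) =
        (exp_B B \<circ> induced_endomorphism M \<phi> \<circ> exp_B (- B)) s +
        (exp_B B \<circ> induced_endomorphism M \<phi> \<circ> exp_B (- B)) t"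
      unfolding st(1,2) B_transform_apply add_Pair C_add[OF st(3,4)] dual_map_add
      unfolding linear_over_add[OF \<phi>_lin st(3,4)] by (simp add: algebra_simps)
  next
    fix r s assume r: "r \<in> smooth_functions M" and "s \<in> vector_fields M \<times> one_forms M"
    then obtain X \<alpha> where s: "s = (X, \<alpha>)" "X \<in> vector_fields M" by blast
    show "(exp_B B \<circ> induced_endomorphism M \<phi> \<circ> exp_B (- B)) (gen_fsmult r s) =
        gen_fsmult r ((exp_B B \<circ> induced_endomorphism M \<phi> \<circ> exp_B (- B)) s)"
      unfolding s(1) gen_fsmult_def map_prod_simp B_transform_apply C_scale[OF r s(2)]
        dual_map_fsmult
      unfolding linear_over_scale[OF \<phi>_lin r s(2)]
      by (simp add: fsmult_def fun_eq_iff right_diff_distrib)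
  qed
qed

theorem proposition3p2:
  fixes M :: "('m::{t2_space,second_countable_topology}, 'e::euclidean_space) atlas"
    and \<phi> :: "'m vfield \<Rightarrow> 'm vfield"
    and \<xi> :: "'m vfield"
    and \<eta> :: "'m form"
    and B :: "'m vfield \<Rightarrow> 'm form"
  assumes "smooth_manifold M"
    and "odd DIM('e)"
    and "almost_paracontact M \<phi> \<xi> \<eta>"
    and "closed_two_form M B"
    and "\<forall>X\<in>vector_fields M. \<forall>Y\<in>vector_fields M. B (\<phi> (\<phi> X)) Y = B (\<phi> X) (\<phi> Y)"
  shows "gen_almost_paracontact M
           (exp_B B \<circ> induced_endomorphism M \<phi> \<circ> exp_B (- B)) \<xi> \<eta>"
proof -
  let ?\<Psi> = "exp_B B \<circ> induced_endomorphism M \<phi> \<circ> exp_B (- B)"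
  have B: "B \<in> two_forms M" using assms(4) by (simp add: closed_two_form_def)
  have \<phi>: "tangent_endomorphism M \<phi>" and \<xi>: "\<xi> \<in> vector_fields M" and \<eta>: "\<eta> \<in> one_forms M"
    and \<phi>2: "\<And>X. X \<in> vector_fields M \<Longrightarrow> \<phi> (\<phi> X) = X - fsmult (\<eta> X) \<xi>"
    and \<eta>\<xi>: "\<eta> \<xi> = 1" and \<phi>\<xi>: "\<phi> \<xi> = 0"
    and \<eta>\<phi>: "\<And>X. X \<in> vector_fields M \<Longrightarrow> \<eta> (\<phi> X) = 0"
    using assms(3) by (auto simp: almost_paracontact_def)
  note \<phi>_lin = \<phi>[unfolded tangent_endomorphism_def]
  note B_lin = two_forms_linear[OF B]
  note \<phi>_img = linear_over_image[OF \<phi>_lin]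
  have zero: "0 \<in> vector_fields M" using \<phi>_img[OF \<xi>] \<phi>\<xi> by simp
  note skew = two_forms_skew[OF assms(1) B]
  have outside: "B Z Y = 0" if "Z \<in> vector_fields M" "Y \<notin> vector_fields M" for Z Y
    using one_forms_outside[OF linear_over_image[OF B_lin that(1)] that(2)] .

  have isotropy: "g0 (?\<Psi> (X, \<alpha>)) (Y, \<gamma>) = - g0 (X, \<alpha>) (?\<Psi> (Y, \<gamma>))"
    if X: "X \<in> vector_fields M" and Y: "Y \<in> vector_fields M" for X Y \<alpha> \<gamma>
  proof
    fix p
    have "B (\<phi> X) Y p = - B Y (\<phi> X) p" "B X (\<phi> Y) p = - B (\<phi> Y) X p"
      using skew[OF \<phi>_img[OF X] Y] skew[OF X \<phi>_img[OF Y]] by (metis uminus_apply)+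
    then show "g0 (?\<Psi> (X, \<alpha>)) (Y, \<gamma>) p = (- g0 (X, \<alpha>) (?\<Psi> (Y, \<gamma>))) p"
      unfolding B_transform_apply using X Y by (simp add: g0_def dual_map_def field_simps)
  qed

  have square: "?\<Psi> (?\<Psi> (X, \<alpha>)) =
      block (id - \<eta> \<otimes>\<^sub>T \<xi>) 0 0 (dual_map M (id - \<eta> \<otimes>\<^sub>T \<xi>)) (X, \<alpha>)"
    if X: "X \<in> vector_fields M" for X \<alpha>
  proof -
    let ?\<beta> = "B (\<phi> X) + dual_map M \<phi> (B X) - dual_map M \<phi> \<alpha>"
    have "B (\<phi> (\<phi> X)) + dual_map M \<phi> (B (\<phi> X)) - dual_map M \<phi> ?\<beta> =
        dual_map M (id - \<eta> \<otimes>\<^sub>T \<xi>) \<alpha>"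
    proof
      fix Y
      show "(B (\<phi> (\<phi> X)) + dual_map M \<phi> (B (\<phi> X)) - dual_map M \<phi> ?\<beta>) Y =
          dual_map M (id - \<eta> \<otimes>\<^sub>T \<xi>) \<alpha> Y"
      proof (cases "Y \<in> vector_fields M")
        case True
        \<comment> \<open>The two terms \<open>B(\<phi> X, \<phi> Y)\<close> cancel; what is left besides \<open>\<alpha>(\<phi>\<^sup>2 Y)\<close> is the difference
          of the two sides of the symmetry of \<open>\<phi>\<^sup>2\<close>.\<close>
        have "B (\<phi> (\<phi> X)) Y = B X (\<phi> (\<phi> Y))"
          by (rule two_form_phi_square_symmetric[where \<phi> = \<phi> and B = B, OF assms(1) \<phi> B assms(5) X True])
        moreover have "(id - \<eta> \<otimes>\<^sub>T \<xi>) Y = \<phi> (\<phi> Y)"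
          using \<phi>2[OF True] by (simp add: tensor_def)
        ultimately show ?thesis
          using True \<phi>_img[OF True] by (simp add: dual_map_def)
      next
        case False
        \<comment> \<open>Off the vector fields both sides have the default value zero.\<close>
        then show ?thesis
          using outside[OF \<phi>_img[OF \<phi>_img[OF X]]] by (simp add: dual_map_def)
      qed
    qed
    then show ?thesis
      unfolding B_transform_apply using \<phi>2[OF X] by (simp add: block_def tensor_def)
  qed

  have annihilates: "?\<Psi> (block (\<eta> \<otimes>\<^sub>T \<xi>) 0 0 (dual_map M (\<eta> \<otimes>\<^sub>T \<xi>)) (X, \<alpha>)) = 0"
    if X: "X \<in> vector_fields M" and \<alpha>: "\<alpha> \<in> one_forms M" for X \<alpha>
  proof -
    have \<eta>X: "\<eta> X \<in> smooth_functions M"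
      using linear_over_image[OF one_forms_linear[OF \<eta>] X] .
    have "\<phi> (fsmult (\<eta> X) \<xi>) = fsmult (\<eta> X) 0"
      using linear_over_scale[OF \<phi>_lin \<eta>X \<xi>] \<phi>\<xi> by simp
    then have vec: "\<phi> (fsmult (\<eta> X) \<xi>) = 0" by (simp add: fsmult_def fun_eq_iff)
    have "dual_map M \<phi> (B (fsmult (\<eta> X) \<xi>)) = fsmult (\<eta> X) (dual_map M \<phi> (B \<xi>))"
      using linear_over_scale[OF B_lin \<eta>X \<xi>] by (simp add: dual_map_fsmult)
    moreover have "dual_map M \<phi> (B \<xi>) = 0"
      using two_form_xi_phi_zero[where \<phi> = \<phi> and B = B, OF assms(1,3) B assms(5)] by (auto simp: dual_map_def fun_eq_iff)
    ultimately have form_B: "dual_map M \<phi> (B (fsmult (\<eta> X) \<xi>)) = 0"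
      by (simp add: fsmult_def fun_eq_iff)
    have "fsmult 0 \<xi> = 0" by (simp add: fsmult_def fun_eq_iff)
    then have "\<alpha> (fsmult (\<eta> (\<phi> Y)) \<xi>) = 0" if "Y \<in> vector_fields M" for Y
      unfolding \<eta>\<phi>[OF that] using linear_over_zero[OF one_forms_linear[OF \<alpha>] zero] by simp
    then have form_\<alpha>: "dual_map M \<phi> (dual_map M (\<eta> \<otimes>\<^sub>T \<xi>) \<alpha>) = 0"
      by (auto simp: dual_map_def tensor_def fun_eq_iff)
    have "block (\<eta> \<otimes>\<^sub>T \<xi>) 0 0 (dual_map M (\<eta> \<otimes>\<^sub>T \<xi>)) (X, \<alpha>) =
        (fsmult (\<eta> X) \<xi>, dual_map M (\<eta> \<otimes>\<^sub>T \<xi>) \<alpha>)"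
      by (simp add: block_def tensor_def)
    then show ?thesis
      using linear_over_zero[OF B_lin zero]
      by (simp add: B_transform_apply vec form_B form_\<alpha> zero_prod_def del: o_apply)
  qed

  have "g0 (\<xi>, \<eta>) (\<xi>, \<eta>) = 1" using \<eta>\<xi> by (simp add: g0_def fun_eq_iff)
  then show ?thesis
    unfolding gen_almost_paracontact_def gen_sections_def
    using B_transform_gen_endomorphism[OF assms(1) \<phi> B] \<xi> \<eta> isotropy square annihilates
    by blast
qed

end
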